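(* Let $m\geq 4$ be an integer and let $t$ be a positive integer such that $p:=\gcd(m,t)$ is a prime and $t+p=2m$. Define a sequence $(c(n))_{n\geq m-1}$ by $c(m-1)=t$ and, for $n\geq m$, $$c(n)=c(n-1)+\gcd(n,\,c(n-1)).$$ Then for every $n\geq m$, the difference $c(n)-c(n-1)$ is either $1$ or a prime. *)

theory Defs
  imports "HOL-Computational_Algebra.Primes"
begin

end

(* Whenever c(k) = 2 k, the gcd at n = k - 1 + s equals gcd (k - 1) s as long as only
   unit steps occurred since k.  Hence the next nonunit step happens when s reaches the
   least prime factor q of k - 1; it adds exactly q, and leads back to c(n) = 2 n. *)

theory Submission
  imports Defs
begin

text \<open>A prime \<open>q\<close> dividing \<open>gcd d s\<close> divides \<open>s\<close>, so
  \<open>q \<le> s\<close>; it also divides \<open>d\<close>, so \<open>s \<le> q\<close>. Hence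
  \<open>s = q\<close> unless the gcd is 1.\<close>

lemma gcd_le_prime_factors_cases:
  fixes d s :: nat
  assumes "\<And>q. prime q \<Longrightarrow> q dvd d \<Longrightarrow> s \<le> q" and "s > 0"
  shows "gcd d s = 1 \<or> prime s \<and> gcd d s = s"
proof (cases "gcd d s = 1")
  case False
  then obtain q where q: "prime q" "q dvd gcd d s"
    using prime_factor_nat by blast
  then have "q = s"
    using assms dvd_imp_le[of q s] by (simp add: order_antisym)
  then show ?thesis
    using q by (simp add: gcd_nat.absorb2)
qed simp

text \<open>Induction step for the sequence, with \<open>n + k\<close> in the role of
  \<open>c n\<close>. The alternatives are the two ways the invariant survives: \<open>k\<close> is
  kept, or \<open>Suc n\<close> replaces it.\<close>

lemma double_state_step:
  fixes k n :: nat
  assumes "0 < k" "k \<le> n"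
    and min: "\<And>q. prime q \<Longrightarrow> q dvd k - 1 \<Longrightarrow> n - k + 1 < q"
  defines "g \<equiv> gcd (Suc n) (n + k)"
  shows "g = 1 \<and> (\<forall>q. prime q \<longrightarrow> q dvd k - 1 \<longrightarrow> Suc n - k + 1 < q)
    \<or> prime g \<and> n + k + g = 2 * Suc n"
proof -
  \<comment> \<open>With \<open>s\<close> the distance from \<open>k - 1\<close> to
    \<open>Suc n\<close>, the bound \<open>min\<close> reads \<open>s \<le> q\<close>, and removing
    \<open>d\<close> twice reduces \<open>g\<close> to \<open>gcd d s\<close>.\<close>
  define d s where "d = k - 1" and "s = n - k + 2"
  have n: "Suc n = s + d" and nk: "n + k = (s + d) + d"
    using assms by (auto simp: d_def s_def)
  have g: "g = gcd d s"
    unfolding g_def n nk by (simp only: gcd_add1 gcd_add2 gcd.commute[of d s])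
  have le: "s \<le> q" if "prime q" "q dvd d" for q
    using min[of q] that by (simp add: d_def s_def)
  consider "gcd d s = 1" | "prime s" "gcd d s = s"
    using gcd_le_prime_factors_cases[of d s] le by (auto simp: s_def)
  then show ?thesis
  proof cases
    case 1
    \<comment> \<open>Equality would make \<open>s\<close> a common factor, so coprimality turns
      \<open>s \<le> q\<close> into the strict bound needed at \<open>Suc n\<close>.\<close>
    have "s \<noteq> q" if "prime q" "q dvd d" for q
      using 1 that by (auto simp: gcd_nat.absorb2)
    then have "\<forall>q. prime q \<longrightarrow> q dvd d \<longrightarrow> s < q"
      using le by (simp add: order_less_le)
    moreover have "s = Suc n - k + 1"
      using assms by (simp add: s_def)
    ultimately show ?thesis
      using 1 g by (simp add: d_def)
  next
    case 2
    \<comment> \<open>Here \<open>g = s = n - k + 2\<close>, so \<open>k\<close> cancels in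
      \<open>n + k + g\<close>.\<close>
    then show ?thesis
      using g assms by (simp add: s_def)
  qed
qed

theorem theorem4:
  fixes m t p :: nat and c :: "nat \<Rightarrow> nat"
  assumes "m \<ge> 4"
    and "t > 0"
    and "p = gcd m t"
    and "prime p"
    and "t + p = 2 * m"
    and "c (m - 1) = t"
    and "\<And>n. n \<ge> m \<Longrightarrow> c n = c (n - 1) + gcd n (c (n - 1))"
  shows "\<forall>n\<ge>m. c n - c (n - 1) = 1 \<or> prime (c n - c (n - 1))"
proof -
  have rec: "c (Suc n) = c n + gcd (Suc n) (c n)" if "m \<le> n" for n
    using assms(7)[of "Suc n"] that by simp
  have cm: "c m = t + p"
    using assms(3,6) assms(7)[of m] by simp
  \<comment> \<open>k is the last index up to n at which c(k) = 2 k.\<close>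
  have inv: "\<exists>k. 0 < k \<and> k \<le> n \<and> c n = n + k \<and>
      (\<forall>q. prime q \<longrightarrow> q dvd k - 1 \<longrightarrow> n - k + 1 < q)" if "m \<le> n" for n
    using that
  proof (induction n rule: dec_induct)
    case base
    \<comment> \<open>The hypothesis \<open>t + p = 2 * m\<close> gives \<open>c m = 2 * m\<close>;
      for \<open>k = n\<close> the bound is just \<open>1 < q\<close>.\<close>
    show ?case
      using assms(1,5) cm by (intro exI[of _ m]) (auto simp: prime_gt_Suc_0_nat)
  next
    case (step n)
    then obtain k where k: "0 < k" "k \<le> n" "c n = n + k"
      "\<And>q. prime q \<Longrightarrow> q dvd k - 1 \<Longrightarrow> n - k + 1 < q"
      by blast
    have c: "c (Suc n) = n + k + gcd (Suc n) (n + k)"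
      using rec[of n] step.hyps k(3) by simp
    from double_state_step[OF k(1,2,4)] show ?case
    proof
      assume "gcd (Suc n) (n + k) = 1 \<and>
        (\<forall>q. prime q \<longrightarrow> q dvd k - 1 \<longrightarrow> Suc n - k + 1 < q)"
      then show ?thesis
        using k(1,2) c by (intro exI[of _ k]) simp
    next
      assume "prime (gcd (Suc n) (n + k)) \<and> n + k + gcd (Suc n) (n + k) = 2 * Suc n"
      then have "c (Suc n) = Suc n + Suc n"
        using c by simp
      then show ?thesis
        by (intro exI[of _ "Suc n"]) (auto simp: prime_gt_Suc_0_nat)
    qed
  qed
  show ?thesis
  proof (intro allI impI)
    fix n assume "m \<le> n"
    show "c n - c (n - 1) = 1 \<or> prime (c n - c (n - 1))"
    \<comment> \<open>The invariant says nothing about \<open>m - 1\<close>; the first difference is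
      \<open>p\<close> itself.\<close>
    proof (cases "n = m")
      case True
      then show ?thesis
        using cm assms(4,6) by simp
    next
      case False
      then obtain j where j: "n = Suc j" "m \<le> j"
        using \<open>m \<le> n\<close> by (cases n) auto
      obtain k where k: "0 < k" "k \<le> j" "c j = j + k"
        "\<And>q. prime q \<Longrightarrow> q dvd k - 1 \<Longrightarrow> j - k + 1 < q"
        using inv[OF j(2)] by blast
      have "c n - c (n - 1) = gcd (Suc j) (j + k)"
        using rec[OF j(2)] j(1) k(3) by simp
      then show ?thesis
        using double_state_step[OF k(1,2,4)] by auto
    qed
  qed
qed

end
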